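(* Let $\mathbf Z=G_z(\boldsymbol\theta_0,\mathbf U)$ with observed value $\mathbf z_{obs}$ and, for $0<\alpha'<1$, let $$\Gamma_{\alpha'}(\mathbf z_{obs})=\{\boldsymbol\theta\in\Theta:\ \exists\,\mathbf u^*\in\mathcal U\text{ such that }\mathbf z_{obs}=G_z(\boldsymbol\theta,\mathbf u^* ),\ T(\mathbf u^*,\boldsymbol\theta)\in B_{\alpha'}(\boldsymbol\theta)\},$$ where $\mathbb P\{T(\mathbf U,\boldsymbol\theta)\in B_{\alpha'}(\boldsymbol\theta)\}\ge\alpha'$ for all $\boldsymbol\theta\in\Theta$ and all $0<\alpha'<1$. Suppose we are interested in testing $H_0:\boldsymbol\theta_0\in\Theta_0$ versus $H_1:\boldsymbol\theta_0\notin\Theta_0$, where $\Theta_0\subset\Theta$, and define the p-value $$p(\mathbf z_{obs})=1-\inf_{\boldsymbol\theta\in\Theta_0}\Big[\inf\{\alpha':\boldsymbol\theta\in\Gamma_{\alpha'}(\mathbf z_{obs})\}\Big].$$ Then rejecting $H_0$ when $p(\mathbf z_{obs})\le\gamma$ leads to a size $\gamma$ test, for any $0<\gamma<1$.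
   Context: $\Theta$ is an arbitrary parameter set and $\boldsymbol\theta_0\in\Theta$ is the true parameter. $\mathbf U$ is a random vector with values in $\mathcal U\subset\mathbb R^r$ whose distribution is known and free of $\boldsymbol\theta_0$. $G_z:\Theta\times\mathcal U\to\mathcal Z\subset\mathbb R^m$ is a known mapping, $T:\mathcal U\times\Theta\to\mathcal T\subseteq\mathbb R^q$ is a given function (called the nuclear mapping), and $B_{\alpha'}(\boldsymbol\theta)$ are Borel sets. The set $\Gamma_{\alpha'}(\mathbf z_{obs})$ is called the level-$\alpha'$ repro samples confidence set for $\boldsymbol\theta_0$. The infimum over $\alpha'$ is over $\alpha'\in(0,1)$, with the convention that the infimum of the empty set is $1$. *)

theory Defs
  imports "HOL-Probability.Probability"
begin

text \<open>
  Infimum for subsets of the unit interval, with the convention that the infimum of the empty set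
  is 1 (on type \<^typ>\<open>real\<close>, \<^term>\<open>Inf {}\<close> is unspecified).
\<close>

definition inf01 :: "real set \<Rightarrow> real" where
  "inf01 A = (if A = {} then 1 else Inf A)"

text \<open>
  The level-\<open>\<alpha>\<close> repro samples confidence set.  Here \<open>\<Theta>\<close> is the parameter set, \<open>\<U>\<close> the
  range of the random vector, \<open>G\<close> the data generating mapping, \<open>T\<close> the nuclear mapping and
  \<open>B \<alpha> \<theta>\<close> the fixed-level sets.
\<close>

definition repro_set ::
  "'p set \<Rightarrow> 'u set \<Rightarrow> ('p \<Rightarrow> 'u \<Rightarrow> 'z) \<Rightarrow> ('u \<Rightarrow> 'p \<Rightarrow> 't) \<Rightarrow> (real \<Rightarrow> 'p \<Rightarrow> 't set)
    \<Rightarrow> real \<Rightarrow> 'z \<Rightarrow> 'p set" where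
  "repro_set \<Theta> \<U> G T B \<alpha> z =
     {\<theta> \<in> \<Theta>. \<exists>u\<in>\<U>. z = G \<theta> u \<and> T u \<theta> \<in> B \<alpha> \<theta>}"

definition repro_pvalue ::
  "'p set \<Rightarrow> 'u set \<Rightarrow> ('p \<Rightarrow> 'u \<Rightarrow> 'z) \<Rightarrow> ('u \<Rightarrow> 'p \<Rightarrow> 't) \<Rightarrow> (real \<Rightarrow> 'p \<Rightarrow> 't set)
    \<Rightarrow> 'p set \<Rightarrow> 'z \<Rightarrow> real" where
  "repro_pvalue \<Theta> \<U> G T B \<Theta>0 z =
     1 - inf01 ((\<lambda>\<theta>. inf01 {\<alpha>. 0 < \<alpha> \<and> \<alpha> < 1 \<and> \<theta> \<in> repro_set \<Theta> \<U> G T B \<alpha> z}) ` \<Theta>0)"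

text \<open>
  Size of the test of \<open>\<theta> \<in> \<Theta>0\<close> with rejection region \<open>R\<close>: the supremum, over all true parameters
  \<open>\<theta> \<in> \<Theta>0\<close>, of the probability that the data \<open>G \<theta> U\<close> fall into \<open>R\<close>.  Rejection regions arising
  from infima over uncountable sets need not give measurable events, and the measure of a
  non-measurable set is 0 by convention; the outer measure avoids this degeneracy and agrees with
  the probability whenever the rejection event is measurable.
\<close>

definition test_size ::
  "'w measure \<Rightarrow> ('w \<Rightarrow> 'u) \<Rightarrow> ('p \<Rightarrow> 'u \<Rightarrow> 'z) \<Rightarrow> 'p set \<Rightarrow> 'z set \<Rightarrow> ennreal" where
  "test_size M U G \<Theta>0 R =
     (SUP \<theta>\<in>\<Theta>0. outer_measure_of M {\<omega> \<in> space M. G \<theta> (U \<omega>) \<in> R})"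

lemma test_size_measurable:
  assumes "\<And>\<theta>. \<theta> \<in> \<Theta>0 \<Longrightarrow> {\<omega> \<in> space M. G \<theta> (U \<omega>) \<in> R} \<in> sets M"
  shows "test_size M U G \<Theta>0 R = (SUP \<theta>\<in>\<Theta>0. emeasure M {\<omega> \<in> space M. G \<theta> (U \<omega>) \<in> R})"
  using assms by (simp add: test_size_def cong: SUP_cong)

end

theory Submission
  imports Defs
begin

text \<open>Let \<theta> in \<open>\<Theta>0\<close> be the true parameter. If the confidence set of
  level \<alpha> covers \<theta>, then \<alpha> competes in the nested infima, so the p-value is at
  least 1 - \<alpha> (\<open>repro_pvalue_ge\<close>). For \<alpha> < 1 - \<gamma> this exceeds
  \<gamma>, hence rejection forces the level-\<alpha> set to miss \<theta>. The realised value of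
  \<open>U\<close> reproduces the data under \<theta>, so a miss means that the nuclear mapping
  falls outside \<open>B \<alpha> \<theta>\<close>, an event of probability at most 1 - \<alpha>.
  Letting \<alpha> increase to 1 - \<gamma> gives the bound \<gamma>.\<close>

lemma inf01_lower:
  assumes "x \<in> A" and "\<And>y. y \<in> A \<Longrightarrow> 0 \<le> y"
  shows "inf01 A \<le> x"
proof -
  have "bdd_below A"
    using assms(2) by (rule bdd_belowI)
  with assms(1) show ?thesis
    by (auto simp: inf01_def intro: cInf_lower)
qed

lemma inf01_nonneg: "(\<And>y. y \<in> A \<Longrightarrow> 0 \<le> y) \<Longrightarrow> 0 \<le> inf01 A"
  by (auto simp: inf01_def intro: cInf_greatest)

text \<open>The parameter \<theta> bounds the outer infimum and the level \<alpha> bounds the inner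
  one, so the nested infimum is at most \<alpha>.\<close>

lemma repro_pvalue_ge:
  assumes "\<theta> \<in> \<Theta>0" and "0 < \<alpha>" and "\<alpha> < 1" and "\<theta> \<in> repro_set \<Theta> \<U> G T B \<alpha> z"
  shows "1 - \<alpha> \<le> repro_pvalue \<Theta> \<U> G T B \<Theta>0 z"
proof -
  let ?A = "\<lambda>\<theta>. {\<alpha>. 0 < \<alpha> \<and> \<alpha> < 1 \<and> \<theta> \<in> repro_set \<Theta> \<U> G T B \<alpha> z}"
  \<comment> \<open>The outer infimum is over a set bounded below by 0, since each inner infimum is
    nonnegative, being 1 when no level qualifies.\<close>
  have "inf01 ((\<lambda>\<theta>. inf01 (?A \<theta>)) ` \<Theta>0) \<le> inf01 (?A \<theta>)"
    using assms(1) by (auto intro!: inf01_lower inf01_nonneg)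
  also have "\<dots> \<le> \<alpha>"
    using assms by (intro inf01_lower) auto
  finally show ?thesis
    by (simp add: repro_pvalue_def)
qed

theorem corollary1:
  fixes M :: "'w measure"
    and \<Theta> \<Theta>0 :: "'p set"
    and \<U> :: "(real ^ 'r) set" and \<Z> :: "(real ^ 'm) set" and \<T> :: "(real ^ 'q) set"
    and U :: "'w \<Rightarrow> real ^ 'r"
    and G :: "'p \<Rightarrow> real ^ 'r \<Rightarrow> real ^ 'm"
    and T :: "real ^ 'r \<Rightarrow> 'p \<Rightarrow> real ^ 'q"
    and B :: "real \<Rightarrow> 'p \<Rightarrow> (real ^ 'q) set"
    and \<gamma> :: real
  assumes "prob_space M"
    and "U \<in> borel_measurable M"
    and "\<And>\<omega>. \<omega> \<in> space M \<Longrightarrow> U \<omega> \<in> \<U>"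
    and "\<And>\<theta> u. \<theta> \<in> \<Theta> \<Longrightarrow> u \<in> \<U> \<Longrightarrow> G \<theta> u \<in> \<Z>"
    and "\<And>\<theta> u. \<theta> \<in> \<Theta> \<Longrightarrow> u \<in> \<U> \<Longrightarrow> T u \<theta> \<in> \<T>"
    and "\<And>\<alpha> \<theta>. 0 < \<alpha> \<Longrightarrow> \<alpha> < 1 \<Longrightarrow> \<theta> \<in> \<Theta> \<Longrightarrow> B \<alpha> \<theta> \<in> sets borel"
    and "\<And>\<alpha> \<theta>. 0 < \<alpha> \<Longrightarrow> \<alpha> < 1 \<Longrightarrow> \<theta> \<in> \<Theta> \<Longrightarrow>
           measure M {\<omega> \<in> space M. T (U \<omega>) \<theta> \<in> B \<alpha> \<theta>} \<ge> \<alpha>"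
    and "\<Theta>0 \<subseteq> \<Theta>"
    and "0 < \<gamma>" and "\<gamma> < 1"
  shows "test_size M U G \<Theta>0 {z \<in> \<Z>. repro_pvalue \<Theta> \<U> G T B \<Theta>0 z \<le> \<gamma>} \<le> ennreal \<gamma>"
proof -
  interpret prob_space M by fact
  let ?R = "{z \<in> \<Z>. repro_pvalue \<Theta> \<U> G T B \<Theta>0 z \<le> \<gamma>}"
  have "outer_measure_of M {\<omega> \<in> space M. G \<theta> (U \<omega>) \<in> ?R} \<le> ennreal \<gamma>" if \<theta>: "\<theta> \<in> \<Theta>0" for \<theta>
  proof -
    let ?E = "{\<omega> \<in> space M. G \<theta> (U \<omega>) \<in> ?R}"
    have "\<theta> \<in> \<Theta>" using \<theta> \<open>\<Theta>0 \<subseteq> \<Theta>\<close> by auto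
    \<comment> \<open>The strict inequality matters: at \<alpha> = 1 - \<gamma>, coverage yields
      only a p-value of at least \<gamma>, which does not exclude rejection.\<close>
    have bound: "outer_measure_of M ?E \<le> ennreal (1 - \<alpha>)" if \<alpha>: "0 < \<alpha>" "\<alpha> < 1 - \<gamma>" for \<alpha>
    proof -
      have "\<alpha> < 1" using \<alpha> \<open>0 < \<gamma>\<close> by simp
      define A where "A = {\<omega> \<in> space M. T (U \<omega>) \<theta> \<in> B \<alpha> \<theta>}"
      have A: "\<alpha> \<le> prob A"
        unfolding A_def using assms(7) \<alpha>(1) \<open>\<alpha> < 1\<close> \<open>\<theta> \<in> \<Theta>\<close> .
      \<comment> \<open>\<open>T\<close> is not assumed measurable, but non-measurable sets have measure 0.\<close>
      then have "A \<in> sets M"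
        using \<alpha>(1) measure_notin_sets[of A M] by force
      have "?E \<subseteq> space M - A"
      proof
        fix \<omega> assume \<omega>: "\<omega> \<in> ?E"
        have "\<theta> \<notin> repro_set \<Theta> \<U> G T B \<alpha> (G \<theta> (U \<omega>))"
          using repro_pvalue_ge[OF \<theta> \<alpha>(1) \<open>\<alpha> < 1\<close>, of \<Theta> \<U> G T B "G \<theta> (U \<omega>)"] \<omega> \<alpha>(2) by auto
        \<comment> \<open>On \<open>A\<close>, the point \<open>U \<omega>\<close> would itself be
          the witness placing \<theta> in the confidence set.\<close>
        then show "\<omega> \<in> space M - A"
          using \<omega> assms(3) \<open>\<theta> \<in> \<Theta>\<close> by (auto simp: repro_set_def A_def)
      qed
      \<comment> \<open>The rejection event may fail to be measurable, but the complement of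
        \<open>A\<close> is a measurable cover, whose outer measure is its probability.\<close>
      then have "outer_measure_of M ?E \<le> outer_measure_of M (space M - A)"
        by (rule outer_measure_of_mono)
      also have "\<dots> = ennreal (1 - prob A)"
        using \<open>A \<in> sets M\<close> by (simp add: emeasure_eq_measure prob_compl)
      also have "\<dots> \<le> ennreal (1 - \<alpha>)"
        using A by (intro ennreal_leI) simp
      finally show ?thesis .
    qed
    \<comment> \<open>The bounds hold only for \<alpha> strictly below 1 - \<gamma>, so \<gamma> is
      reached as their limit from the left.\<close>
    have "((\<lambda>\<alpha>. ennreal (1 - \<alpha>)) \<longlongrightarrow> ennreal (1 - (1 - \<gamma>))) (at_left (1 - \<gamma>))"
      by (intro tendsto_intros)
    moreover have "\<forall>\<^sub>F \<alpha> in at_left (1 - \<gamma>). outer_measure_of M ?E \<le> ennreal (1 - \<alpha>)"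
      using eventually_at_leftI[of 0 "1 - \<gamma>"] bound \<open>\<gamma> < 1\<close> by simp
    ultimately have "outer_measure_of M ?E \<le> ennreal (1 - (1 - \<gamma>))"
      by (rule tendsto_lowerbound) simp
    then show ?thesis by simp
  qed
  then show ?thesis
    unfolding test_size_def by (rule SUP_least)
qed

end
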